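(* As $k\to\infty$, $$\tilde F_{\mathrm{Shearer}}(k)=\frac{2^k}{ek}+\Theta\Bigl(\frac{2^k}{k^3}\Bigr),$$ whereas $$F_{\mathrm{MT}}(k)\ \ge\ \frac{2^k}{ek}+\Omega\Bigl(\frac{2^k}{k^2}\Bigr);$$ thus, there is a large and growing gap between $F_{\mathrm{MT}}(k)$ and $\tilde F_{\mathrm{Shearer}}(k)$.
   Context: For integers $k\ge 2$ define $$F_{\mathrm{MT}}(k)=\Bigl\lfloor \frac{(2^k-1)(1-1/k)^{k-1}}{k}\Bigr\rfloor ,\qquad \tilde F_{\mathrm{Shearer}}(k)=\Bigl\lfloor \max_{t\in(2^{-k/(k-1)},\,2)}\Bigl(1-\frac{\ln(2-t)}{\ln\bigl(1-2^{-k}t^{1-k}\bigr)}\Bigr)\Bigr\rfloor .$$ Here $\Theta(\cdot)$ and $\Omega(\cdot)$ denote positive quantities of the indicated order as $k\to\infty$. *)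

theory Defs
  imports Complex_Main "HOL-Library.Landau_Symbols"
begin

text \<open>Both thresholds are meant for \<open>k \<ge> 2\<close>; smaller arguments yield irrelevant values.\<close>

definition F_MT :: "nat \<Rightarrow> int" where
  "F_MT k = \<lfloor>(2 ^ k - 1) * (1 - 1 / real k) ^ (k - 1) / real k\<rfloor>"

definition Shearer_fun :: "nat \<Rightarrow> real \<Rightarrow> real" where
  "Shearer_fun k t = 1 - ln (2 - t) / ln (1 - 2 powi (- int k) * t powi (1 - int k))"

definition Shearer_dom :: "nat \<Rightarrow> real set" where
  "Shearer_dom k = {2 powr (- real k / (real k - 1)) <..< 2}"

text \<open>The maximum over the open interval is taken literally, as the greatest attained value
  (not as a supremum); \<open>Max\<close> is only meaningful for finite sets.\<close>

definition F_Shearer :: "nat \<Rightarrow> int" where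
  "F_Shearer k = \<lfloor>GREATEST y. y \<in> Shearer_fun k ` Shearer_dom k\<rfloor>"

text \<open>The library's Landau symbols compare absolute values, so a \<^emph>\<open>positive\<close> quantity of the
  given order additionally needs to be eventually positive.\<close>

definition pos_bigtheta :: "(nat \<Rightarrow> real) \<Rightarrow> (nat \<Rightarrow> real) \<Rightarrow> bool" where
  "pos_bigtheta f g \<longleftrightarrow> f \<in> \<Theta>(g) \<and> eventually (\<lambda>k. 0 < f k) at_top"

definition pos_bigomega :: "(nat \<Rightarrow> real) \<Rightarrow> (nat \<Rightarrow> real) \<Rightarrow> bool" where
  "pos_bigomega f g \<longleftrightarrow> f \<in> \<Omega>(g) \<and> eventually (\<lambda>k. 0 < f k) at_top"

end

(* With a = 2^k t^(k-1) the denominator of Shearer's function satisfies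
   a - 1 <= -1 / ln (1 - 1/a) <= a, so up to a bounded error the threshold is 2^k times the
   maximum of t^(k-1) ln (2-t) over [1/2,1] (elsewhere the function is at most 2).
   The point t = 1 - 1/k gives the lower bound.
   For the upper bound substitute t = exp (-w): since ln (2-t) / t = w + O(w^3) has no quadratic
   term, the maximum is at most that of (w + 4 w^3) exp (-k w), which is 1/(e k) + O(1/k^3).
   In contrast, (1 - 1/k)^(k-1) = (1 + 1/(2k) + ...)/e has a first-order term. *)
theory Submission
  imports Defs "HOL-Real_Asymp.Real_Asymp"
begin

section \<open>Elementary inequalities for logarithms and exponentials\<close>

lemma ln_one_plus_le_cubic:
  fixes u :: real
  assumes "0 \<le> u"
  shows "ln (1 + u) \<le> u - u\<^sup>2 / 2 + u ^ 3 / 3"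
proof -
  let ?g = "\<lambda>x::real. x - x\<^sup>2 / 2 + x ^ 3 / 3 - ln (1 + x)"
  have "?g 0 \<le> ?g u"
  proof (rule DERIV_nonneg_imp_nondecreasing[OF assms], intro exI conjI)
    fix x :: real assume x: "0 \<le> x" "x \<le> u"
    show "(?g has_real_derivative (1 - x + x\<^sup>2 - 1 / (1 + x))) (at x)"
      using x by (auto intro!: derivative_eq_intros)
    have "1 - x + x\<^sup>2 - 1 / (1 + x) = x ^ 3 / (1 + x)"
      using x by (simp add: field_simps power2_eq_square power3_eq_cube)
    then show "0 \<le> 1 - x + x\<^sup>2 - 1 / (1 + x)"
      using x by simp
  qed
  then show ?thesis by simp
qed

lemma minus_ln_one_minus_ge_quadratic:
  fixes u :: real
  assumes "0 \<le> u" "u < 1"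
  shows "u + u\<^sup>2 / 2 \<le> - ln (1 - u)"
proof -
  let ?g = "\<lambda>x::real. - ln (1 - x) - x - x\<^sup>2 / 2"
  have "?g 0 \<le> ?g u"
  proof (rule DERIV_nonneg_imp_nondecreasing[OF assms(1)], intro exI conjI)
    fix x :: real assume x: "0 \<le> x" "x \<le> u"
    show "(?g has_real_derivative (1 / (1 - x) - 1 - x)) (at x)"
      using x assms by (auto intro!: derivative_eq_intros)
    have "1 / (1 - x) - 1 - x = x\<^sup>2 / (1 - x)"
      using x assms by (simp add: field_simps power2_eq_square)
    then show "0 \<le> 1 / (1 - x) - 1 - x"
      using x assms by simp
  qed
  then show ?thesis by simp
qed

text \<open>With \<open>u = 1 - t\<close>, both \<open>ln (1 + u)\<close> and
  \<open>(1 - u) * (u + u^2 / 2)\<close> begin with \<open>u - u^2 / 2\<close>, so only a cubic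
  correction in \<open>- ln t\<close> is needed. The factor \<open>t\<close> is split off because it
  later completes \<open>t ^ (k - 1)\<close> to \<open>t ^ k\<close>, a pure exponential in
  \<open>- ln t\<close>.\<close>

lemma ln_two_minus_le:
  fixes t :: real
  assumes "1 / 2 \<le> t" "t \<le> 1"
  shows "ln (2 - t) \<le> t * (- ln t + 4 * (- ln t) ^ 3)"
proof -
  define u where "u = 1 - t"
  have u: "0 \<le> u" "u \<le> 1 / 2" "t = 1 - u"
    using assms by (auto simp: u_def)
  have w: "u + u\<^sup>2 / 2 \<le> - ln t"
    using minus_ln_one_minus_ge_quadratic[of u] u by simp
  moreover have "u \<le> u + u\<^sup>2 / 2" by simp
  ultimately have "u ^ 3 \<le> (- ln t) ^ 3"
    using u(1) by (intro power_mono) linarith+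
  then have "(1 - u) * (u + u\<^sup>2 / 2 + 4 * u ^ 3) \<le> t * (- ln t + 4 * (- ln t) ^ 3)"
    using w u by (intro mult_mono) auto
  moreover have "u - u\<^sup>2 / 2 + u ^ 3 / 3 \<le> (1 - u) * (u + u\<^sup>2 / 2 + 4 * u ^ 3)"
  proof -
    \<comment> \<open>The terms of order 1 and 2 cancel. The generous coefficient 4 keeps the
      remaining factor at least 7/6 for \<open>u\<close> up to 1/2.\<close>
    have "(1 - u) * (u + u\<^sup>2 / 2 + 4 * u ^ 3) - (u - u\<^sup>2 / 2 + u ^ 3 / 3)
        = u ^ 3 * (19 / 6 - 4 * u)"
      by (simp add: field_simps power2_eq_square power3_eq_cube)
    also have "\<dots> \<ge> 0"
      using u by simp
    finally show ?thesis by simp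
  qed
  moreover have "ln (2 - t) \<le> u - u\<^sup>2 / 2 + u ^ 3 / 3"
    using ln_one_plus_le_cubic[OF u(1)] u(3) by simp
  ultimately show ?thesis by linarith
qed

text \<open>This is \<open>1 + x <= exp x\<close> at \<open>x = c * w - 1\<close>, with equality at
  \<open>w = 1 / c\<close>; hence the sharp constant \<open>1 / exp 1\<close> in the main
  term.\<close>

lemma mult_exp_minus_le:
  fixes w c :: real
  assumes "0 < c"
  shows "w * exp (- (c * w)) \<le> 1 / (exp 1 * c)"
proof -
  have "c * w \<le> exp (c * w - 1)"
    using exp_ge_add_one_self[of "c * w - 1"] by simp
  then show ?thesis
    using assms by (simp add: exp_diff exp_minus field_simps)
qed

text \<open>Cubing \<open>x <= exp x\<close> at \<open>x = c * w / 3\<close> gives the constant 27.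
  Sharpness is irrelevant here, since only the order of the error term counts.\<close>

lemma cube_mult_exp_minus_le:
  fixes w c :: real
  assumes "0 \<le> w" "0 < c"
  shows "w ^ 3 * exp (- (c * w)) \<le> 27 / c ^ 3"
proof -
  have "(c * w / 3) ^ 3 \<le> exp (c * w / 3) ^ 3"
    using assms exp_gt_self[of "c * w / 3"] by (intro power_mono) auto
  also have "\<dots> = exp (c * w)"
    by (simp flip: exp_of_nat_mult)
  finally show ?thesis
    using assms by (simp add: exp_minus field_simps)
qed

text \<open>In the variable \<open>w = - ln t\<close> the two summands \<open>w\<close> and
  \<open>4 * w ^ 3\<close> are maximised separately against \<open>exp (- (k * w))\<close>; 108 is 4
  times 27.\<close>

lemma power_mult_ln_two_minus_le:
  fixes t :: real
  assumes "1 / 2 \<le> t" "t \<le> 1" "0 < k"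
  shows "t ^ (k - 1) * ln (2 - t) \<le> 1 / (exp 1 * real k) + 108 / real k ^ 3"
proof -
  define w where "w = - ln t"
  have w: "0 \<le> w" and tk: "t ^ k = exp (- (real k * w))"
    using assms by (auto simp: w_def exp_of_nat_mult)
  have "t ^ (k - 1) * ln (2 - t) \<le> t ^ (k - 1) * (t * (w + 4 * w ^ 3))"
    using ln_two_minus_le[OF assms(1,2)] assms unfolding w_def
    by (intro mult_left_mono) auto
  also have "\<dots> = t ^ k * (w + 4 * w ^ 3)"
    using assms(3) by (cases k) auto
  also have "\<dots> = w * exp (- (real k * w)) + 4 * (w ^ 3 * exp (- (real k * w)))"
    unfolding tk by (simp add: algebra_simps)
  also have "\<dots> \<le> 1 / (exp 1 * real k) + 4 * (27 / real k ^ 3)"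
    using mult_exp_minus_le[of "real k" w] cube_mult_exp_minus_le[of w "real k"] w assms(3)
    by (intro add_mono mult_left_mono) auto
  finally show ?thesis by simp
qed

section \<open>Bounds for Shearer's function and its maximum\<close>

lemma inverse_minus_ln_one_minus_inverse_bounds:
  fixes a :: real
  assumes "1 < a"
  shows "a - 1 \<le> 1 / (- ln (1 - 1 / a))" "1 / (- ln (1 - 1 / a)) \<le> a"
    and "0 < - ln (1 - 1 / a)"
proof -
  \<comment> \<open>The logarithm is squeezed between \<open>1 / a\<close> and
    \<open>1 / (a - 1)\<close>: \<open>ln (1 + x) <= x\<close> is used once at
    \<open>x = - 1 / a\<close> and, through this identity, once at
    \<open>x = 1 / (a - 1)\<close>.\<close>
  have eq: "- ln (1 - 1 / a) = ln (1 + 1 / (a - 1))"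
    using assms by (subst ln_inverse[symmetric]) (auto simp: field_simps)
  have "ln (1 - 1 / a) \<le> - (1 / a)"
    using ln_le_minus_one[of "1 - 1 / a"] assms by simp
  then have lo: "1 / a \<le> - ln (1 - 1 / a)" by simp
  moreover have "0 < 1 / a" using assms by simp
  ultimately show pos: "0 < - ln (1 - 1 / a)" by linarith
  have hi: "- ln (1 - 1 / a) \<le> 1 / (a - 1)"
    unfolding eq using assms by (intro ln_add_one_self_le_self) auto
  show "a - 1 \<le> 1 / (- ln (1 - 1 / a))"
    using hi pos assms by (simp add: field_simps del: ln_le_zero_iff)
  show "1 / (- ln (1 - 1 / a)) \<le> a"
    using lo pos assms by (simp add: field_simps)
qed

lemma Shearer_fun_eq:
  assumes "0 < k" "0 < t"
  shows "Shearer_fun k t = 1 + ln (2 - t) * (1 / (- ln (1 - 1 / (2 ^ k * t ^ (k - 1)))))"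
proof -
  have "t powi (1 - int k) = inverse (t ^ (k - 1))"
    using assms by (cases k) (auto simp: power_int_minus)
  then show ?thesis
    by (simp add: Shearer_fun_def power_int_minus field_simps)
qed

text \<open>The left endpoint of the domain is exactly the \<open>t\<close> at which
  \<open>2 ^ k * t ^ (k - 1)\<close> equals 1, where the argument of the logarithm in the
  denominator reaches 0.\<close>

lemma mem_Shearer_domD:
  assumes "t \<in> Shearer_dom k" "2 \<le> k"
  shows "0 < t" "t < 2" "1 < 2 ^ k * t ^ (k - 1)"
proof -
  have lo: "2 powr (- real k / (real k - 1)) < t" and hi: "t < 2"
    using assms by (auto simp: Shearer_dom_def)
  show t: "0 < t" using lo by (rule le_less_trans[OF powr_ge_zero])
  show "t < 2" by (rule hi)
  have "(2 powr (- real k / (real k - 1))) ^ (k - 1) < t ^ (k - 1)"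
    using lo assms(2) by (intro power_strict_mono) auto
  moreover have "(2 powr (- real k / (real k - 1))) ^ (k - 1) = (1 / 2 ^ k :: real)"
  proof -
    have "(2 powr (- real k / (real k - 1))) ^ (k - 1)
        = 2 powr (- real k / (real k - 1) * real (k - 1))"
      by (simp add: powr_powr flip: powr_realpow)
    also have "- real k / (real k - 1) * real (k - 1) = - real k"
      using assms(2) by (simp add: of_nat_diff)
    finally show ?thesis
      by (simp add: powr_minus powr_realpow field_simps)
  qed
  ultimately have "1 / 2 ^ k < t ^ (k - 1)"
    by (simp only:)
  then show "1 < 2 ^ k * t ^ (k - 1)"
    by (simp add: field_simps)
qed

lemma half_le_imp_mem_Shearer_dom:
  assumes "1 / 2 \<le> t" "t \<le> 1" "2 \<le> k"
  shows "t \<in> Shearer_dom k"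
proof -
  \<comment> \<open>The exponent equals \<open>- 1 - 1 / (k - 1)\<close>, so the left endpoint lies
    strictly below 1/2.\<close>
  have "- real k / (real k - 1) < -1"
    using assms(3) by (simp add: field_simps)
  then have "2 powr (- real k / (real k - 1)) < 2 powr (-1 :: real)"
    by (intro powr_less_mono) auto
  then show ?thesis
    using assms by (auto simp: Shearer_dom_def powr_minus)
qed

lemma two_le_pow_mult_pow:
  fixes t :: real
  assumes "1 / 2 \<le> t" "0 < k"
  shows "2 \<le> 2 ^ k * t ^ (k - 1)"
proof -
  obtain m where m: "k = Suc m" using assms(2) by (cases k) auto
  have "1 \<le> (2 * t) ^ m" using assms by (intro one_le_power) auto
  then show ?thesis by (simp add: m power_mult_distrib)
qed

lemma Shearer_fun_le:
  assumes "1 / 2 \<le> t" "t \<le> 1" "0 < k"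
  shows "Shearer_fun k t \<le> 1 + 2 ^ k * (1 / (exp 1 * real k) + 108 / real k ^ 3)"
proof -
  let ?a = "2 ^ k * t ^ (k - 1)"
  have a: "1 < ?a" using two_le_pow_mult_pow[of t k] assms by simp
  have "Shearer_fun k t = 1 + ln (2 - t) * (1 / (- ln (1 - 1 / ?a)))"
    using assms by (intro Shearer_fun_eq) auto
  also have "\<dots> \<le> 1 + ln (2 - t) * ?a"
    using inverse_minus_ln_one_minus_inverse_bounds(2)[OF a] assms
    by (intro add_left_mono mult_left_mono) auto
  also have "ln (2 - t) * ?a = 2 ^ k * (t ^ (k - 1) * ln (2 - t))" by simp
  also have "\<dots> \<le> 2 ^ k * (1 / (exp 1 * real k) + 108 / real k ^ 3)"
    using power_mult_ln_two_minus_le[OF assms] by (intro mult_left_mono) auto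
  finally show ?thesis by simp
qed

lemma Shearer_fun_ge:
  assumes "1 / 2 \<le> t" "t \<le> 1" "0 < k"
  shows "2 ^ k * t ^ (k - 1) * ln (2 - t) \<le> Shearer_fun k t"
proof -
  let ?a = "2 ^ k * t ^ (k - 1)"
  have a: "1 < ?a" using two_le_pow_mult_pow[of t k] assms by simp
  \<comment> \<open>Replacing the reciprocal logarithm by \<open>?a - 1\<close> loses
    \<open>ln (2 - t)\<close> compared with \<open>?a\<close>; this is absorbed by the leading 1 of
    Shearer's function.\<close>
  have "ln (2 - t) \<le> 1"
    using ln_le_minus_one[of "2 - t"] assms by simp
  then have "?a * ln (2 - t) \<le> 1 + ln (2 - t) * (?a - 1)"
    by (simp add: algebra_simps)
  also have "\<dots> \<le> 1 + ln (2 - t) * (1 / (- ln (1 - 1 / ?a)))"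
    using inverse_minus_ln_one_minus_inverse_bounds(1)[OF a] assms
    by (intro add_left_mono mult_left_mono) auto
  also have "\<dots> = Shearer_fun k t"
    using assms by (intro Shearer_fun_eq[symmetric]) auto
  finally show ?thesis .
qed

text \<open>For \<open>t > 1\<close> the numerator \<open>ln (2 - t)\<close> is negative. For
  \<open>t < 1 / 2\<close> the quantity \<open>?a\<close> is at most 2, so the denominator is at
  least \<open>ln 2\<close>, which dominates the numerator. The search for the maximum thus reduces
  to a compact interval.\<close>

lemma Shearer_fun_le_2_outside:
  assumes "t \<in> Shearer_dom k" "2 \<le> k" "t < 1 / 2 \<or> 1 < t"
  shows "Shearer_fun k t \<le> 2"
proof -
  let ?a = "2 ^ k * t ^ (k - 1)"
  note t = mem_Shearer_domD[OF assms(1,2)]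
  note pos = inverse_minus_ln_one_minus_inverse_bounds(3)[OF t(3)]
  have eq: "Shearer_fun k t = 1 + ln (2 - t) * (1 / (- ln (1 - 1 / ?a)))"
    using assms t by (intro Shearer_fun_eq) auto
  show ?thesis
  proof (cases "1 < t")
    case True
    then have "ln (2 - t) * (1 / (- ln (1 - 1 / ?a))) \<le> 0"
      using pos t by (intro mult_nonpos_nonneg) auto
    then show ?thesis using eq by simp
  next
    case False
    with assms(3) have half: "t < 1 / 2" by simp
    have "?a = 2 * (2 * t) ^ (k - 1)"
      using assms(2) by (cases k) (auto simp: power_mult_distrib)
    moreover have "(2 * t) ^ (k - 1) \<le> 1"
      using half t by (intro power_le_one) auto
    ultimately have "?a \<le> 2" by linarith
    then have "1 - 1 / ?a \<le> 1 / 2"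
      using t(3) by (simp add: field_simps)
    then have "ln (1 - 1 / ?a) \<le> ln (1 / 2)"
      using t(3) by (subst ln_le_cancel_iff) auto
    then have "ln 2 \<le> - ln (1 - 1 / ?a)"
      by (simp add: ln_div)
    moreover have "ln (2 - t) \<le> ln 2"
      using t by simp
    ultimately have "ln (2 - t) / (- ln (1 - 1 / ?a)) \<le> 1"
      using pos by (subst divide_le_eq_1_pos) linarith+
    then show ?thesis using eq by simp
  qed
qed

text \<open>Continuity gives a maximiser on the compact interval from 1/2 to 1. A value of at least
  2 at \<open>t0\<close> makes it a maximiser on the whole open domain, so \<open>GREATEST\<close>
  denotes an attained value.\<close>

lemma Shearer_max:
  assumes "2 \<le> k" "1 / 2 \<le> t0" "t0 \<le> 1" "2 \<le> Shearer_fun k t0"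
  obtains t where "1 / 2 \<le> t" "t \<le> 1" "Shearer_fun k t0 \<le> Shearer_fun k t"
    and "F_Shearer k = \<lfloor>Shearer_fun k t\<rfloor>"
proof -
  let ?f = "\<lambda>t::real. 1 + ln (2 - t) * (1 / (- ln (1 - 1 / (2 ^ k * t ^ (k - 1)))))"
  have a: "1 < 2 ^ k * t ^ (k - 1)" if "t \<in> {1 / 2..1}" for t :: real
    using two_le_pow_mult_pow[of t k] that assms by simp
  \<comment> \<open>These are the side conditions for continuity of the divisions and the inner
    logarithm.\<close>
  have ne: "2 ^ k * t ^ (k - 1) \<noteq> 0" "1 - 1 / (2 ^ k * t ^ (k - 1)) \<noteq> 0"
      "- ln (1 - 1 / (2 ^ k * t ^ (k - 1))) \<noteq> 0" if "t \<in> {1 / 2..1}" for t :: real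
    using a[OF that] inverse_minus_ln_one_minus_inverse_bounds(3)[OF a[OF that]] that
    by auto
  have "continuous_on {1 / 2..1} ?f"
    by (intro continuous_intros ballI ne) auto
  then have "continuous_on {1 / 2..1} (Shearer_fun k)"
    using assms(1) by (subst continuous_on_cong[OF refl Shearer_fun_eq]) auto
  then obtain t where t: "t \<in> {1 / 2..1}" "\<And>x. x \<in> {1 / 2..1} \<Longrightarrow> Shearer_fun k x \<le> Shearer_fun k t"
    using continuous_attains_sup[of "{1 / 2..1::real}" "Shearer_fun k"] by auto
  have ge: "Shearer_fun k t0 \<le> Shearer_fun k t"
    using t(2)[of t0] assms by auto
  have "(GREATEST y. y \<in> Shearer_fun k ` Shearer_dom k) = Shearer_fun k t"
  proof (rule Greatest_equality)
    show "Shearer_fun k t \<in> Shearer_fun k ` Shearer_dom k"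
      using half_le_imp_mem_Shearer_dom[of t k] t(1) assms(1) by auto
    fix y assume "y \<in> Shearer_fun k ` Shearer_dom k"
    then obtain x where x: "x \<in> Shearer_dom k" "y = Shearer_fun k x" by auto
    show "y \<le> Shearer_fun k t"
    proof (cases "x \<in> {1 / 2..1}")
      case True
      then show ?thesis using t(2) x by simp
    next
      case False
      then have "x < 1 / 2 \<or> 1 < x" by auto
      then show ?thesis
        using Shearer_fun_le_2_outside[OF x(1) assms(1)] x(2) ge assms(4) by auto
    qed
  qed
  then show ?thesis
    using t(1) ge by (intro that[of t]) (simp_all add: F_Shearer_def)
qed

text \<open>\<open>L k\<close> is the lower bound for Shearer's function at
  \<open>t = 1 - 1 / k\<close>, close to the maximiser \<open>w = 1 / k\<close> of
  \<open>w * exp (- (k * w))\<close>. The floor costs at most 1.\<close>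

lemma F_Shearer_bounds:
  defines "L \<equiv> \<lambda>k. 2 ^ k * (1 - 1 / real k) ^ (k - 1) * ln (1 + 1 / real k)"
  assumes "2 \<le> k" "2 \<le> L k"
  shows "L k - 1 \<le> real_of_int (F_Shearer k)"
    and "real_of_int (F_Shearer k) \<le> 1 + 2 ^ k * (1 / (exp 1 * real k) + 108 / real k ^ 3)"
proof -
  let ?t0 = "1 - 1 / real k"
  have t0: "1 / 2 \<le> ?t0" "?t0 \<le> 1"
    using assms(2) by (auto simp: field_simps)
  have L: "L k \<le> Shearer_fun k ?t0"
    using Shearer_fun_ge[OF t0, of k] assms(2) by (simp add: L_def)
  have "2 \<le> Shearer_fun k ?t0"
    using L assms(3) by simp
  from Shearer_max[OF assms(2) t0 this] obtain t where
    t: "1 / 2 \<le> t" "t \<le> 1" "Shearer_fun k ?t0 \<le> Shearer_fun k t"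
       "F_Shearer k = \<lfloor>Shearer_fun k t\<rfloor>" .
  show "L k - 1 \<le> real_of_int (F_Shearer k)"
    using L t(3,4) by linarith
  show "real_of_int (F_Shearer k) \<le> 1 + 2 ^ k * (1 / (exp 1 * real k) + 108 / real k ^ 3)"
    using Shearer_fun_le[OF t(1,2), of k] assms(2) t(4) by linarith
qed

section \<open>Asymptotic expansions and the gap\<close>

lemma pos_bigomegaI:
  assumes "0 < c" "\<forall>\<^sub>F k in at_top. c * g k \<le> f k" "\<forall>\<^sub>F k in at_top. 0 < g k"
  shows "pos_bigomega f g"
proof -
  have "\<forall>\<^sub>F k in at_top. 0 < f k"
    using assms(2,3) by eventually_elim (metis assms(1) less_le_trans mult_pos_pos)
  moreover have "f \<in> \<Omega>(g)"
  proof (rule landau_omega.bigI[OF assms(1)])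
    show "\<forall>\<^sub>F k in at_top. c * norm (g k) \<le> norm (f k)"
      using assms(2,3) by eventually_elim auto
  qed
  ultimately show ?thesis by (simp add: pos_bigomega_def)
qed

lemma pos_bigthetaI:
  assumes "0 < c" "\<forall>\<^sub>F k in at_top. c * g k \<le> f k" "\<forall>\<^sub>F k in at_top. f k \<le> C * g k"
    and "\<forall>\<^sub>F k in at_top. 0 < g k"
  shows "pos_bigtheta f g"
proof -
  have om: "pos_bigomega f g"
    using assms(1,2,4) by (rule pos_bigomegaI)
  then have "\<forall>\<^sub>F k in at_top. 0 < f k" by (simp add: pos_bigomega_def)
  with assms(3,4) have "\<forall>\<^sub>F k in at_top. norm (f k) \<le> C * norm (g k)"
    by eventually_elim auto
  then have "f \<in> O(g)" by (rule bigoI)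
  with om show ?thesis by (auto simp: pos_bigtheta_def pos_bigomega_def bigtheta_def)
qed

text \<open>Trades the truncated subtraction in the exponent for a real exponent, the form in which
  \<open>real_asymp\<close> is applied below.\<close>

lemma eventually_power_pred_eq_powr:
  "\<forall>\<^sub>F k in at_top. (1 - 1 / real k) ^ (k - 1) = (1 - 1 / real k) powr (real k - 1)"
  using eventually_ge_at_top[of 2]
proof eventually_elim
  case (elim k)
  then have "0 < 1 - 1 / real k" by (simp add: field_simps)
  then show ?case
    using elim by (simp add: powr_realpow[symmetric] of_nat_diff)
qed

lemma F_Shearer_eventually:
  shows "\<forall>\<^sub>F k in at_top. 2 ^ k / (exp 1 * real k) + exp (- 1) / 10 * (2 ^ k / real k ^ 3)
      \<le> real_of_int (F_Shearer k)"
    and "\<forall>\<^sub>F k in at_top. real_of_int (F_Shearer k)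
      \<le> 2 ^ k / (exp 1 * real k) + 109 * (2 ^ k / real k ^ 3)"
proof -
  have "\<forall>\<^sub>F k in at_top. 2 \<le> (2::real) ^ k * (1 - 1 / real k) powr (real k - 1) * ln (1 + 1 / real k)"
    by real_asymp
  with eventually_power_pred_eq_powr
  have large: "\<forall>\<^sub>F k in at_top. 2 \<le> (2::real) ^ k * (1 - 1 / real k) ^ (k - 1) * ln (1 + 1 / real k)"
    by eventually_elim simp
  \<comment> \<open>The factor \<open>exp (- 1) * (1 + 1/(2k) + 7/(24k^2) + ...)\<close> times
    \<open>1/k - 1/(2k^2) + 1/(3k^3) - ...\<close> is
    \<open>exp (- 1) * (1/k + 3/(8k^3) + ...)\<close>: the second-order terms cancel. As 1/10 is
    below 3/8, there is room for the 1 lost to the floor.\<close>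
  have "\<forall>\<^sub>F k in at_top. exp (- 1) * 2 ^ k / real k + exp (- 1) / 10 * (2 ^ k / real k ^ 3)
      \<le> 2 ^ k * (1 - 1 / real k) powr (real k - 1) * ln (1 + 1 / real k) - 1"
    by real_asymp
  then show "\<forall>\<^sub>F k in at_top. 2 ^ k / (exp 1 * real k) + exp (- 1) / 10 * (2 ^ k / real k ^ 3)
      \<le> real_of_int (F_Shearer k)"
    using eventually_power_pred_eq_powr large eventually_ge_at_top[of 2]
  proof eventually_elim
    case (elim k)
    moreover have "exp (- 1) * 2 ^ k / real k = 2 ^ k / (exp 1 * real k)"
      by (simp add: exp_minus divide_simps)
    ultimately show ?case using F_Shearer_bounds(1)[of k] by simp
  qed
  \<comment> \<open>Raising 108 to 109 absorbs the additive 1.\<close>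
  have "\<forall>\<^sub>F k in at_top. 1 + 2 ^ k * (1 / (exp 1 * real k) + 108 / real k ^ 3)
      \<le> 2 ^ k / (exp 1 * real k) + 109 * (2 ^ k / real k ^ 3)"
    by real_asymp
  then show "\<forall>\<^sub>F k in at_top. real_of_int (F_Shearer k)
      \<le> 2 ^ k / (exp 1 * real k) + 109 * (2 ^ k / real k ^ 3)"
    using large eventually_ge_at_top[of 2]
  proof eventually_elim
    case (elim k)
    then show ?case using F_Shearer_bounds(2)[of k] by simp
  qed
qed

lemma F_MT_eventually_ge:
  "\<forall>\<^sub>F k in at_top. 2 ^ k / (exp 1 * real k) + exp (- 1) / 10 * (2 ^ k / real k ^ 2)
      \<le> real_of_int (F_MT k)"
proof -
  \<comment> \<open>Here the term \<open>1/(2k)\<close> of the expansion survives, so any constant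
    below 1/2 in place of 1/10 would do.\<close>
  have "\<forall>\<^sub>F k in at_top. exp (- 1) * 2 ^ k / real k + exp (- 1) / 10 * (2 ^ k / real k ^ 2)
      \<le> (2 ^ k - 1) * (1 - 1 / real k) powr (real k - 1) / real k - 1"
    by real_asymp
  then show ?thesis
    using eventually_power_pred_eq_powr
  proof eventually_elim
    case (elim k)
    moreover have "exp (- 1) * 2 ^ k / real k = 2 ^ k / (exp 1 * real k)"
      by (simp add: exp_minus divide_simps)
    ultimately have "2 ^ k / (exp 1 * real k) + exp (- 1) / 10 * (2 ^ k / real k ^ 2)
        \<le> (2 ^ k - 1) * (1 - 1 / real k) ^ (k - 1) / real k - 1"
      by simp
    then show ?case unfolding F_MT_def by linarith
  qed
qed

theorem mainTheorem2:
  shows "(\<exists>r. pos_bigtheta r (\<lambda>k. 2 ^ k / real k ^ 3) \<and>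
           (\<forall>\<^sub>F k in at_top. real_of_int (F_Shearer k) = 2 ^ k / (exp 1 * real k) + r k))
       \<and> (\<exists>s. pos_bigomega s (\<lambda>k. 2 ^ k / real k ^ 2) \<and>
           (\<forall>\<^sub>F k in at_top. real_of_int (F_MT k) \<ge> 2 ^ k / (exp 1 * real k) + s k))
       \<and> pos_bigomega (\<lambda>k. real_of_int (F_MT k) - real_of_int (F_Shearer k))
           (\<lambda>k. 2 ^ k / real k ^ 2)
       \<and> filterlim (\<lambda>k. real_of_int (F_MT k) - real_of_int (F_Shearer k)) at_top at_top"
proof (intro conjI exI)
  have pos2: "\<forall>\<^sub>F k in at_top. 0 < (2::real) ^ k / real k ^ 2"
    and pos3: "\<forall>\<^sub>F k in at_top. 0 < (2::real) ^ k / real k ^ 3"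
    by real_asymp+
  \<comment> \<open>The witnesses \<open>r\<close> and \<open>s\<close> are the deviations from the
    main term themselves, so the two expansions hold trivially.\<close>
  show "pos_bigtheta (\<lambda>k. real_of_int (F_Shearer k) - 2 ^ k / (exp 1 * real k))
      (\<lambda>k. 2 ^ k / real k ^ 3)"
  proof (rule pos_bigthetaI[where c = "exp (- 1) / 10" and C = 109, OF _ _ _ pos3])
    show "\<forall>\<^sub>F k in at_top. exp (- 1) / 10 * (2 ^ k / real k ^ 3)
        \<le> real_of_int (F_Shearer k) - 2 ^ k / (exp 1 * real k)"
      using F_Shearer_eventually(1) by eventually_elim linarith
    show "\<forall>\<^sub>F k in at_top. real_of_int (F_Shearer k) - 2 ^ k / (exp 1 * real k)
        \<le> 109 * (2 ^ k / real k ^ 3)"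
      using F_Shearer_eventually(2) by eventually_elim linarith
  qed simp
  show "pos_bigomega (\<lambda>k. real_of_int (F_MT k) - 2 ^ k / (exp 1 * real k))
      (\<lambda>k. 2 ^ k / real k ^ 2)"
  proof (rule pos_bigomegaI[where c = "exp (- 1) / 10", OF _ _ pos2])
    show "\<forall>\<^sub>F k in at_top. exp (- 1) / 10 * (2 ^ k / real k ^ 2)
        \<le> real_of_int (F_MT k) - 2 ^ k / (exp 1 * real k)"
      using F_MT_eventually_ge by eventually_elim linarith
  qed simp
  \<comment> \<open>Half of the lower-bound constant \<open>exp (- 1) / 10\<close> is spent on the
    cubic-order error of \<open>F_Shearer\<close>; the other half remains as the gap.\<close>
  have "\<forall>\<^sub>F k in at_top. 109 * ((2::real) ^ k / real k ^ 3) \<le> exp (- 1) / 20 * (2 ^ k / real k ^ 2)"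
    by real_asymp
  then have gap: "\<forall>\<^sub>F k in at_top. exp (- 1) / 20 * (2 ^ k / real k ^ 2)
      \<le> real_of_int (F_MT k) - real_of_int (F_Shearer k)"
    using F_MT_eventually_ge F_Shearer_eventually(2) by eventually_elim linarith
  show "pos_bigomega (\<lambda>k. real_of_int (F_MT k) - real_of_int (F_Shearer k))
      (\<lambda>k. 2 ^ k / real k ^ 2)"
    by (rule pos_bigomegaI[where c = "exp (- 1) / 20", OF _ gap pos2]) simp
  have "filterlim (\<lambda>k. exp (- 1) / 20 * ((2::real) ^ k / real k ^ 2)) at_top at_top"
    by real_asymp
  then show "filterlim (\<lambda>k. real_of_int (F_MT k) - real_of_int (F_Shearer k)) at_top at_top"
    by (rule filterlim_at_top_mono[OF _ gap])
qed auto

end
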